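(* Let $A$ be a real $2\times2$ matrix with radial and tangential functions $\mathcal{R}$ and $\mathcal{T}$ and with $m_R,m_T,p,\theta_R,\delta_R,\rho_1,\rho_2$ as defined in the context. (i) The vector $V=\begin{pmatrix}\cos\phi\\ \sin\phi\end{pmatrix}\in S^1$ is an orthovector of $A$ with corresponding orthovalue $\mu=\mathcal{T}(\phi)$ if and only if $\mathcal{R}(\phi)=0$. (ii) If $A$ has real orthovalues and $\mathcal{R}\not\equiv0$, then the orthovectors are at angles $$\phi_1=\theta_R-\delta_R \pmod\pi\quad\text{and}\quad \phi_2=\theta_R+\delta_R\pmod\pi,$$ with corresponding orthovalues $\mu_i=\mathcal{T}(\phi_i)$, $i=1,2$. (iii) The orthovalues of $A$, whether real or complex, are given by $$\mu_1=m_T+p_T\quad\text{and}\quad\mu_2=m_T-p_T,\qquad\text{where } p_T=\sqrt{p^2-m_R^2}=\sqrt{-\rho_1\rho_2}.$$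
   Context: For $A=\begin{pmatrix} a_{11} & a_{12}\\ a_{21} & a_{22}\end{pmatrix}$ real put $m_R=\tfrac12(a_{11}+a_{22})$, $m_T=\tfrac12(a_{21}-a_{12})$, $p=\tfrac12\sqrt{(a_{11}-a_{22})^2+(a_{12}+a_{21})^2}$ and, if $p\ne0$, $\theta_R=\tfrac12\arctan(a_{12}+a_{21},a_{11}-a_{22})\in\mathbb{R}\pmod\pi$, where $\arctan(y,x)\in\mathbb{R}\pmod{2\pi}$ is the polar angle of $(x,y)$. The radial and tangential functions are $\mathcal{R}(\theta)=m_R+p\cos(2(\theta-\theta_R))$ and $\mathcal{T}(\theta)=m_T-p\sin(2(\theta-\theta_R))$ (when $p=0$: $\mathcal{R}\equiv m_R$, $\mathcal{T}\equiv m_T$). Let $\rho_1=m_R+p$ and $\rho_2=m_R-p$ (maximum and minimum of $\mathcal{R}$). If $\mathcal{R}\not\equiv0$ has a zero, the reactivity radius $\delta_R\ge0$ is defined by $\mathcal{R}(\theta_R-\delta_R)=\mathcal{R}(\theta_R+\delta_R)=0$ and $\mathcal{R}>0$ on $(\theta_R-\delta_R,\theta_R+\delta_R)\subset\mathbb{R}\pmod\pi$. Write $J=\begin{pmatrix}0&-1\\1&0\end{pmatrix}$ and $V^\perp=JV$. A nonzero $V\in\mathbb{R}^2$ is an orthovector of $A$ with orthovalue $\mu$ if $AV=\mu V^\perp$. Complex orthovalues are understood in the same way with complex $V\neq0$ and $\mu$, i.e. the orthovalues of $A$ (real or complex) are the eigenvalues of $-JA$. In (iii), the square root is imaginary when its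 argument is negative. *)

theory Defs
  imports "HOL-Analysis.Analysis" "HOL-Library.Real_Mod"
begin

definition m_R :: "real^2^2 \<Rightarrow> real" where
  "m_R A = (A$1$1 + A$2$2) / 2"

definition m_T :: "real^2^2 \<Rightarrow> real" where
  "m_T A = (A$2$1 - A$1$2) / 2"

definition p_amp :: "real^2^2 \<Rightarrow> real" where
  "p_amp A = sqrt ((A$1$1 - A$2$2)\<^sup>2 + (A$1$2 + A$2$1)\<^sup>2) / 2"

text \<open>
  The angle \<open>\<theta>\<^sub>R\<close> is only determined modulo \<open>\<pi>\<close>; halving the principal argument selects the
  representative in \<open>(-\<pi>/2, \<pi>/2]\<close>. If \<open>p_amp A = 0\<close> then \<open>Arg 0 = 0\<close> gives the value \<open>0\<close>,
  which is irrelevant because \<open>theta_R A\<close> then enters \<open>radial\<close> and \<open>tangential\<close> with factor \<open>0\<close>.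
\<close>

definition theta_R :: "real^2^2 \<Rightarrow> real" where
  "theta_R A = Arg (Complex (A$1$1 - A$2$2) (A$1$2 + A$2$1)) / 2"

definition radial :: "real^2^2 \<Rightarrow> real \<Rightarrow> real" where
  "radial A \<theta> = m_R A + p_amp A * cos (2 * (\<theta> - theta_R A))"

definition tangential :: "real^2^2 \<Rightarrow> real \<Rightarrow> real" where
  "tangential A \<theta> = m_T A - p_amp A * sin (2 * (\<theta> - theta_R A))"

definition rho1 :: "real^2^2 \<Rightarrow> real" where
  "rho1 A = m_R A + p_amp A"

definition rho2 :: "real^2^2 \<Rightarrow> real" where
  "rho2 A = m_R A - p_amp A"

text \<open>
  Angles are represented by real numbers and \<open>radial A\<close> is \<open>\<pi>\<close>-periodic, so the arc
  \<open>(\<theta>\<^sub>R - \<delta>, \<theta>\<^sub>R + \<delta>)\<close> modulo \<open>\<pi>\<close> is the image of the real interval below.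
\<close>

definition is_reactivity_radius :: "real^2^2 \<Rightarrow> real \<Rightarrow> bool" where
  "is_reactivity_radius A \<delta> \<longleftrightarrow> \<delta> \<ge> 0 \<and>
     radial A (theta_R A - \<delta>) = 0 \<and> radial A (theta_R A + \<delta>) = 0 \<and>
     (\<forall>\<theta> \<in> {theta_R A - \<delta> <..< theta_R A + \<delta>}. radial A \<theta> > 0)"

definition reactivity_radius :: "real^2^2 \<Rightarrow> real" where
  "reactivity_radius A = (THE \<delta>. is_reactivity_radius A \<delta>)"

lemma ex1_reactivity_radius:
  assumes "\<exists>\<theta>. radial A \<theta> \<noteq> 0" and "\<exists>\<theta>. radial A \<theta> = 0"
  shows "\<exists>!\<delta>. is_reactivity_radius A \<delta>"
proof (rule ex_ex1I)
  have p: "p_amp A > 0"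
  proof -
    have "p_amp A \<ge> 0" by (simp add: p_amp_def)
    moreover have "p_amp A \<noteq> 0" using assms by (auto simp: radial_def)
    ultimately show ?thesis by linarith
  qed
  obtain t where t: "m_R A + p_amp A * cos (2 * (t - theta_R A)) = 0"
    using assms(2) by (auto simp: radial_def)
  define c where "c = - m_R A / p_amp A"
  have c: "c = cos (2 * (t - theta_R A))" using t p by (simp add: c_def field_simps)
  have c1: "-1 \<le> c" "c \<le> 1" unfolding c by simp_all
  define d where "d = arccos c / 2"
  have d: "d \<ge> 0" "2 * d \<le> pi" using arccos_lbound[OF c1] arccos_ubound[OF c1] by (auto simp: d_def)
  have m: "m_R A = - p_amp A * cos (2 * d)"
    using p c1 by (simp add: d_def cos_arccos) (simp add: c_def)
  have "radial A \<theta> > 0" if "\<theta> \<in> {theta_R A - d <..< theta_R A + d}" for \<theta>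
  proof -
    have "cos (2 * d) < cos \<bar>2 * (\<theta> - theta_R A)\<bar>"
      using that d by (intro cos_monotone_0_pi) auto
    then show ?thesis using p by (simp add: radial_def m)
  qed
  then have "is_reactivity_radius A d"
    using d m by (auto simp: is_reactivity_radius_def radial_def)
  then show "\<exists>\<delta>. is_reactivity_radius A \<delta>" ..
next
  have le: "b \<le> a" if "is_reactivity_radius A a" "is_reactivity_radius A b" for a b
  proof (rule ccontr)
    assume "\<not> b \<le> a"
    with that have "theta_R A + a \<in> {theta_R A - b <..< theta_R A + b}"
      by (simp add: is_reactivity_radius_def)
    with that(2) have "radial A (theta_R A + a) > 0"
      unfolding is_reactivity_radius_def by blast
    with that(1) show False by (simp add: is_reactivity_radius_def)
  qed
  fix a b assume "is_reactivity_radius A a" "is_reactivity_radius A b"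
  then show "a = b" using le by (meson order_antisym)
qed

text \<open>
  Orthovectors are defined over an arbitrary field, so that the real and the complex notions are
  instances of one definition; a real matrix is regarded as complex via
  \<^term>\<open>map_matrix complex_of_real\<close>.
\<close>

definition J_mat :: "'a::field^2^2" where
  "J_mat = vector [vector [0, -1], vector [1, 0]]"

definition perp :: "'a::field^2 \<Rightarrow> 'a^2" where
  "perp V = J_mat *v V"

definition orthovector :: "'a::field^2^2 \<Rightarrow> 'a \<Rightarrow> 'a^2 \<Rightarrow> bool" where
  "orthovector A \<mu> V \<longleftrightarrow> V \<noteq> 0 \<and> A *v V = \<mu> *s perp V"

definition orthovalue :: "'a::field^2^2 \<Rightarrow> 'a \<Rightarrow> bool" where
  "orthovalue A \<mu> \<longleftrightarrow> (\<exists>V. orthovector A \<mu> V)"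

definition unit_vec :: "real \<Rightarrow> real^2" where
  "unit_vec \<phi> = vector [cos \<phi>, sin \<phi>]"

text \<open>\<open>csqrt\<close> is the principal square root, imaginary for negative real arguments.\<close>

definition p_T :: "real^2^2 \<Rightarrow> complex" where
  "p_T A = csqrt (complex_of_real ((p_amp A)\<^sup>2 - (m_R A)\<^sup>2))"

end

theory Submission
  imports Defs
begin

text \<open>
  In the orthonormal frame of \<open>u = unit_vec \<phi>\<close> and \<open>perp u\<close> one has
  \<open>A u = radial A \<phi> u + tangential A \<phi> perp u\<close>, so \<open>u\<close> is an orthovector exactly when the radial
  part vanishes. The zeros of \<open>radial A\<close> solve \<open>cos (2 (\<phi> - \<theta>\<^sub>R)) = cos (2 \<delta>\<^sub>R)\<close>, with
  \<open>\<delta>\<^sub>R\<close> in \<open>[0, \<pi>/2]\<close>, whence the sign of \<open>p sin (2 \<delta>\<^sub>R) = p\<^sub>T\<close>. Over the reals and the complex numbers alike, \<open>\<mu>\<close> is an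
  orthovalue iff \<open>det (A - \<mu> J) = 0\<close>, which is \<open>(\<mu> - m\<^sub>T)\<^sup>2 = p\<^sup>2 - m\<^sub>R\<^sup>2\<close> after completing the square.
\<close>

section \<open>Orthovalues as zeros of a determinant, over any field\<close>

lemma vec2_eq_iff: "V = W \<longleftrightarrow> V$1 = W$1 \<and> V$2 = W$2" for V W :: "'a^2"
  by (simp add: vec_eq_iff forall_2)

lemma orthovector_iff:
  "orthovector A \<mu> V \<longleftrightarrow> (V$1 \<noteq> 0 \<or> V$2 \<noteq> 0) \<and>
     A$1$1 * V$1 + A$1$2 * V$2 = - (\<mu> * V$2) \<and> A$2$1 * V$1 + A$2$2 * V$2 = \<mu> * V$1"
  by (simp add: orthovector_def perp_def J_mat_def vec2_eq_iff matrix_vector_mult_def sum_2)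

text \<open>Allows real orthovectors to be normalised to unit length.\<close>

lemma orthovector_scale:
  assumes "r \<noteq> 0"
  shows "orthovector A \<mu> (r *s V) \<longleftrightarrow> orthovector A \<mu> V"
proof -
  have "A$i$1 * (r * V$1) + A$i$2 * (r * V$2) = r * (A$i$1 * V$1 + A$i$2 * V$2)" for i
    by (simp add: algebra_simps)
  moreover have "- (\<mu> * (r * V$2)) = r * - (\<mu> * V$2)" "\<mu> * (r * V$1) = r * (\<mu> * V$1)"
    by (simp_all add: algebra_simps)
  ultimately show ?thesis
    using assms
    by (simp only: orthovector_iff vector_smult_component mult_cancel_left mult_eq_0_iff simp_thms)
qed

lemma orthovalue_iff:
  fixes A :: "'a::field^2^2"
  shows
  "orthovalue A \<mu> \<longleftrightarrow> (A$1$2 + \<mu>) * (A$2$1 - \<mu>) = A$1$1 * A$2$2"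
  (is "_ \<longleftrightarrow> ?det")
proof
  assume "orthovalue A \<mu>"
  then obtain V :: "'a^2" where nz: "V$1 \<noteq> 0 \<or> V$2 \<noteq> 0"
    and V: "A$1$1 * V$1 + A$1$2 * V$2 = - (\<mu> * V$2)" "A$2$1 * V$1 + A$2$2 * V$2 = \<mu> * V$1"
    unfolding orthovalue_def orthovector_iff by blast
  \<comment> \<open>Eliminating one unknown from the system \<open>(A - \<mu> J) V = 0\<close>
    leaves the determinant, up to sign, times the other.\<close>
  have "((A$1$2 + \<mu>) * (A$2$1 - \<mu>) - A$1$1 * A$2$2) * V$1 = 0"
    using V by algebra
  moreover have "((A$1$2 + \<mu>) * (A$2$1 - \<mu>) - A$1$1 * A$2$2) * V$2 = 0"
    using V by algebra
  ultimately show ?det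
    using nz by auto
next
  assume det: ?det
  show "orthovalue A \<mu>"
  proof (cases "A$1$1 = 0 \<and> A$1$2 + \<mu> = 0")
    case False
    \<comment> \<open>The first row of \<open>A - \<mu> J\<close> annihilates this witness
      identically; the second does so because the determinant is zero.\<close>
    have "orthovector A \<mu> (vector [A$1$2 + \<mu>, - A$1$1])"
      unfolding orthovector_iff using False det by (auto simp: algebra_simps)
    then show ?thesis unfolding orthovalue_def ..
  next
    case first_row: True
    show ?thesis
    proof (cases "A$2$1 - \<mu> = 0 \<and> A$2$2 = 0")
      case False
      \<comment> \<open>The first row is zero here, so a vector annihilated by the second row
        suffices.\<close>
      have "orthovector A \<mu> (vector [A$2$2, \<mu> - A$2$1])"
        unfolding orthovector_iff using False first_row by (auto simp: algebra_simps add_eq_0_iff)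
      then show ?thesis unfolding orthovalue_def ..
    next
      case True
      have "orthovector A \<mu> (vector [1, 0])"
        unfolding orthovector_iff using True first_row by auto
      then show ?thesis unfolding orthovalue_def ..
    qed
  qed
qed

section \<open>Polar form of the radial and tangential functions\<close>

lemma p_amp_cos_sin:
  "p_amp A * cos (2 * theta_R A) = (A$1$1 - A$2$2) / 2"
  "p_amp A * sin (2 * theta_R A) = (A$1$2 + A$2$1) / 2"
proof -
  define z where "z = Complex (A$1$1 - A$2$2) (A$1$2 + A$2$1)"
  have "2 * p_amp A = cmod z"
    by (simp add: p_amp_def z_def complex_norm)
  moreover have "2 * theta_R A = Arg z"
    by (simp add: theta_R_def z_def)
  \<comment> \<open>The identity also holds for \<open>z = 0\<close>, so \<open>p_amp A = 0\<close>
    needs no separate case.\<close>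
  ultimately have "rcis (2 * p_amp A) (2 * theta_R A) = z"
    by (simp add: rcis_cmod_Arg)
  from arg_cong[OF this, of Re] arg_cong[OF this, of Im] show
    "p_amp A * cos (2 * theta_R A) = (A$1$1 - A$2$2) / 2"
    "p_amp A * sin (2 * theta_R A) = (A$1$2 + A$2$1) / 2"
    by (simp_all add: z_def)
qed

lemma radial_eq:
  "radial A \<phi> = m_R A + (A$1$1 - A$2$2) / 2 * cos (2 * \<phi>) + (A$1$2 + A$2$1) / 2 * sin (2 * \<phi>)"
  unfolding radial_def p_amp_cos_sin[symmetric]
  by (simp add: right_diff_distrib cos_diff algebra_simps)

lemma tangential_eq:
  "tangential A \<phi> = m_T A + (A$1$2 + A$2$1) / 2 * cos (2 * \<phi>) - (A$1$1 - A$2$2) / 2 * sin (2 * \<phi>)"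
  unfolding tangential_def p_amp_cos_sin[symmetric]
  by (simp add: right_diff_distrib sin_diff algebra_simps)

lemma unit_vec_nth [simp]: "unit_vec \<phi> $ 1 = cos \<phi>" "unit_vec \<phi> $ 2 = sin \<phi>"
  by (simp_all add: unit_vec_def)

lemma matrix_unit_vec:
  "A$1$1 * cos \<phi> + A$1$2 * sin \<phi> = radial A \<phi> * cos \<phi> - tangential A \<phi> * sin \<phi>"
  "A$2$1 * cos \<phi> + A$2$2 * sin \<phi> = radial A \<phi> * sin \<phi> + tangential A \<phi> * cos \<phi>"
proof -
  have sc: "(sin \<phi>)\<^sup>2 + (cos \<phi>)\<^sup>2 = 1" by simp
  \<comment> \<open>Doubling clears the halves: what remains are polynomial identities modulo sin^2
    + cos^2 = 1.\<close>
  have R: "2 * radial A \<phi> = (A$1$1 + A$2$2) + (A$1$1 - A$2$2) * ((cos \<phi>)\<^sup>2 - (sin \<phi>)\<^sup>2)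
      + (A$1$2 + A$2$1) * (2 * sin \<phi> * cos \<phi>)"
    unfolding radial_eq m_R_def cos_double sin_double by (simp add: field_simps)
  have T: "2 * tangential A \<phi> = (A$2$1 - A$1$2) + (A$1$2 + A$2$1) * ((cos \<phi>)\<^sup>2 - (sin \<phi>)\<^sup>2)
      - (A$1$1 - A$2$2) * (2 * sin \<phi> * cos \<phi>)"
    unfolding tangential_eq m_T_def cos_double sin_double by (simp add: field_simps)
  have "2 * (A$1$1 * cos \<phi> + A$1$2 * sin \<phi>)
      = 2 * radial A \<phi> * cos \<phi> - 2 * tangential A \<phi> * sin \<phi>"
    unfolding R T using sc by algebra
  then show "A$1$1 * cos \<phi> + A$1$2 * sin \<phi> = radial A \<phi> * cos \<phi> - tangential A \<phi> * sin \<phi>"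
    by simp
  have "2 * (A$2$1 * cos \<phi> + A$2$2 * sin \<phi>)
      = 2 * radial A \<phi> * sin \<phi> + 2 * tangential A \<phi> * cos \<phi>"
    unfolding R T using sc by algebra
  then show "A$2$1 * cos \<phi> + A$2$2 * sin \<phi> = radial A \<phi> * sin \<phi> + tangential A \<phi> * cos \<phi>"
    by simp
qed

lemma orthovector_unit_vec_iff:
  "orthovector A \<mu> (unit_vec \<phi>) \<longleftrightarrow> radial A \<phi> = 0 \<and> \<mu> = tangential A \<phi>"
proof -
  define R T where "R = radial A \<phi>" and "T = tangential A \<phi> - \<mu>"
  have nz: "cos \<phi> \<noteq> 0 \<or> sin \<phi> \<noteq> 0"
    using sin_cos_squared_add[of \<phi>] by fastforce
  have "orthovector A \<mu> (unit_vec \<phi>) \<longleftrightarrow>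
      R * cos \<phi> - T * sin \<phi> = 0 \<and> R * sin \<phi> + T * cos \<phi> = 0"
    unfolding orthovector_iff unit_vec_nth matrix_unit_vec R_def T_def
    using nz by (auto simp: algebra_simps)
  \<comment> \<open>The system says that the rotation by \<phi> sends (R, T) to 0, and a rotation is
    injective.\<close>
  also have "\<dots> \<longleftrightarrow> R = 0 \<and> T = 0"
  proof
    assume RT: "R * cos \<phi> - T * sin \<phi> = 0 \<and> R * sin \<phi> + T * cos \<phi> = 0"
    have "(sin \<phi>)\<^sup>2 + (cos \<phi>)\<^sup>2 = 1" by simp
    with RT have "R = 0" "T = 0" by algebra+
    then show "R = 0 \<and> T = 0" ..
  qed simp
  finally show ?thesis
    by (auto simp: R_def T_def)
qed

lemma vec2_polar:
  fixes V :: "real^2"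
  assumes "V \<noteq> 0"
  obtains r \<phi> where "r > 0" "V = r *s unit_vec \<phi>"
proof
  define z where "z = Complex (V$1) (V$2)"
  show "cmod z > 0"
    using assms by (auto simp: z_def vec2_eq_iff complex_eq_iff)
  have "rcis (cmod z) (Arg z) = z" by (rule rcis_cmod_Arg)
  from arg_cong[OF this, of Re] arg_cong[OF this, of Im]
  show "V = cmod z *s unit_vec (Arg z)"
    by (simp add: vec2_eq_iff) (simp add: z_def)
qed

text \<open>Positive \<open>r\<close> reaches every direction, since negating a vector shifts its
  polar angle by \<pi>.\<close>

lemma orthovector_polar_iff:
  fixes A :: "real^2^2"
  shows "orthovector A \<mu> V \<longleftrightarrow>
    (\<exists>r>0. \<exists>\<phi>. V = r *s unit_vec \<phi> \<and> radial A \<phi> = 0 \<and> \<mu> = tangential A \<phi>)"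
proof
  assume V: "orthovector A \<mu> V"
  then have "V \<noteq> 0" by (simp add: orthovector_def)
  then obtain r \<phi> where "r > 0" "V = r *s unit_vec \<phi>" by (rule vec2_polar)
  with V show "\<exists>r>0. \<exists>\<phi>. V = r *s unit_vec \<phi> \<and> radial A \<phi> = 0 \<and> \<mu> = tangential A \<phi>"
    using orthovector_scale[of r A \<mu> "unit_vec \<phi>"] orthovector_unit_vec_iff by auto
qed (auto simp: orthovector_scale orthovector_unit_vec_iff)

section \<open>Orthovalues by completing the square\<close>

lemma orthovalue_iff_square:
  fixes A :: "'a::field_char_0^2^2"
  shows "orthovalue A \<mu> \<longleftrightarrow> (2 * \<mu> - (A$2$1 - A$1$2))\<^sup>2 =
     (A$1$1 - A$2$2)\<^sup>2 + (A$1$2 + A$2$1)\<^sup>2 - (A$1$1 + A$2$2)\<^sup>2"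
proof -
  \<comment> \<open>The factor 4 completes the square without division. Everything stays in matrix
    entries so that the result applies to complex matrices, whereas \<open>p_amp\<close> takes real
    ones.\<close>
  have "(2 * \<mu> - (A$2$1 - A$1$2))\<^sup>2 -
     ((A$1$1 - A$2$2)\<^sup>2 + (A$1$2 + A$2$1)\<^sup>2 - (A$1$1 + A$2$2)\<^sup>2) =
     4 * (A$1$1 * A$2$2 - (A$1$2 + \<mu>) * (A$2$1 - \<mu>))"
    by (simp add: power2_eq_square algebra_simps)
  then show ?thesis
    unfolding orthovalue_iff by (smt (verit) eq_iff_diff_eq_0 mult_eq_0_iff zero_neq_numeral)
qed

lemma p_amp_square: "4 * (p_amp A)\<^sup>2 = (A$1$1 - A$2$2)\<^sup>2 + (A$1$2 + A$2$1)\<^sup>2"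
  by (simp add: p_amp_def power_divide)

lemma p_amp_m_R_square:
  "4 * ((p_amp A)\<^sup>2 - (m_R A)\<^sup>2) =
     (A$1$1 - A$2$2)\<^sup>2 + (A$1$2 + A$2$1)\<^sup>2 - (A$1$1 + A$2$2)\<^sup>2"
  using p_amp_square[of A] by (simp add: m_R_def power_divide field_simps)

text \<open>Whatever the sign of \<open>(p_amp A)\<^sup>2 - (m_R A)\<^sup>2\<close>, it is the
  square of \<open>p_T A\<close>, so extracting roots gives both values.\<close>

lemma complex_orthovalue_iff:
  "orthovalue (map_matrix complex_of_real A) \<mu> \<longleftrightarrow>
     \<mu> \<in> {complex_of_real (m_T A) + p_T A, complex_of_real (m_T A) - p_T A}"
proof -
  have "orthovalue (map_matrix complex_of_real A) \<mu> \<longleftrightarrow>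
      (2 * \<mu> - (of_real (A$2$1) - of_real (A$1$2)))\<^sup>2 =
      of_real (4 * ((p_amp A)\<^sup>2 - (m_R A)\<^sup>2))"
    unfolding orthovalue_iff_square p_amp_m_R_square by (simp add: map_matrix_def)
  also have "\<dots> \<longleftrightarrow> (2 * (\<mu> - of_real (m_T A)))\<^sup>2 = (2 * p_T A)\<^sup>2"
    proof -
    have "2 * complex_of_real (m_T A) = of_real (A$2$1) - of_real (A$1$2)"
      by (simp add: m_T_def)
    then show ?thesis
      by (simp add: p_T_def right_diff_distrib power_mult_distrib[of _ "p_T A"])
  qed
  also have "\<dots> \<longleftrightarrow> \<mu> - of_real (m_T A) = p_T A \<or> \<mu> - of_real (m_T A) = - p_T A"
    unfolding power_mult_distrib by (simp add: power2_eq_iff)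
  finally show ?thesis
    by (auto simp: algebra_simps)
qed

text \<open>The determinant equation transfers along the injective homomorphism
  \<open>complex_of_real\<close>, so the real orthovalues are exactly the complex ones that are
  real.\<close>

lemma orthovalue_complex_of_real:
  "orthovalue (map_matrix complex_of_real A) (complex_of_real \<mu>) \<longleftrightarrow> orthovalue A \<mu>"
proof -
  have "orthovalue (map_matrix complex_of_real A) (complex_of_real \<mu>) \<longleftrightarrow>
      complex_of_real ((A$1$2 + \<mu>) * (A$2$1 - \<mu>)) = complex_of_real (A$1$1 * A$2$2)"
    unfolding orthovalue_iff by (simp add: map_matrix_def)
  then show ?thesis
    unfolding orthovalue_iff of_real_eq_iff .
qed

section \<open>Halving angle congruences\<close>

lemma rcong_mult_left_cancel:
  assumes "c \<noteq> 0"
  shows "[c * a = c * b] (rmod c * m) \<longleftrightarrow> [a = b] (rmod m)"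
  using rcong_mult_modulus[of a b "c * m" c] rcong_divide_modulus[of "c * a" "c * b" m c] assms
  by (auto simp: mult.commute)

text \<open>Equal cosines mean equal or opposite angles modulo 2 \<pi>; halving turns the modulus
  into \<pi>.\<close>

lemma cos_double_eq_iff_rcong:
  "cos (2 * (\<phi> - \<theta>)) = cos (2 * d) \<longleftrightarrow> [\<phi> = \<theta> - d] (rmod pi) \<or> [\<phi> = \<theta> + d] (rmod pi)"
  (is "_ \<longleftrightarrow> ?rhs")
proof -
  have "cos (2 * (\<phi> - \<theta>)) = cos (2 * d) \<longleftrightarrow>
      [2 * (\<phi> - \<theta>) = 2 * d] (rmod 2 * pi) \<or> [2 * (\<phi> - \<theta>) = 2 * - d] (rmod 2 * pi)"
    by (simp add: cos_eq_cos_conv_rmod_iff)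
  also have "\<dots> \<longleftrightarrow> [\<phi> - \<theta> = d] (rmod pi) \<or> [\<phi> - \<theta> = - d] (rmod pi)"
    by (simp only: rcong_mult_left_cancel zero_neq_numeral[symmetric] not_False_eq_True)
  also have "\<dots> \<longleftrightarrow> ?rhs"
    using rcong_add_right_cancel[of "\<phi> - \<theta>" \<theta> d pi] rcong_add_right_cancel[of "\<phi> - \<theta>" \<theta> "- d" pi]
    by (auto simp: algebra_simps)
  finally show ?thesis .
qed

section \<open>Zeros of \<open>radial A\<close> and the reactivity radius\<close>

context
  fixes A :: "real^2^2"
  assumes nonzero: "\<exists>\<theta>. radial A \<theta> \<noteq> 0" and zero: "\<exists>\<theta>. radial A \<theta> = 0"
begin

lemma is_reactivity_radius_reactivity_radius:
  "is_reactivity_radius A (reactivity_radius A)"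
  unfolding reactivity_radius_def by (rule theI' [OF ex1_reactivity_radius [OF nonzero zero]])

text \<open>With zero amplitude \<open>radial A\<close> would be constant, contradicting the two
  context assumptions.\<close>

lemma p_amp_pos: "p_amp A > 0"
proof -
  have "p_amp A \<ge> 0" by (simp add: p_amp_def)
  moreover have "p_amp A \<noteq> 0" using nonzero zero by (auto simp: radial_def)
  ultimately show ?thesis by linarith
qed

lemma m_R_reactivity_radius: "m_R A = - p_amp A * cos (2 * reactivity_radius A)"
  using is_reactivity_radius_reactivity_radius
  by (simp add: is_reactivity_radius_def radial_def)

lemma reactivity_radius_nonneg: "reactivity_radius A \<ge> 0"
  using is_reactivity_radius_reactivity_radius by (simp add: is_reactivity_radius_def)

lemma reactivity_radius_le: "reactivity_radius A \<le> pi / 2"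
proof (rule ccontr)
  let ?\<delta> = "reactivity_radius A"
  assume "\<not> ?\<delta> \<le> pi / 2"
  text \<open>Then the open arc contains the angle at which \<open>radial A\<close> attains its minimum.\<close>
  then have "radial A (theta_R A + pi / 2) > 0"
    using is_reactivity_radius_reactivity_radius pi_gt_zero unfolding is_reactivity_radius_def
    by (auto elim!: bspec simp del: pi_gt_zero)
  \<comment> \<open>The minimum is \<open>m_R A - p_amp A\<close>, that is
    \<open>- p_amp A * (1 + cos (2 * ?\<delta>))\<close>, which is at most 0.\<close>
  moreover have "cos (2 * ?\<delta>) * p_amp A \<ge> - 1 * p_amp A"
    using p_amp_pos by (intro mult_right_mono) auto
  ultimately show False
    by (simp add: radial_def m_R_reactivity_radius mult.commute)
qed

lemma radial_eq_0_iff: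
  "radial A \<phi> = 0 \<longleftrightarrow> [\<phi> = theta_R A - reactivity_radius A] (rmod pi) \<or>
     [\<phi> = theta_R A + reactivity_radius A] (rmod pi)"
  using p_amp_pos unfolding cos_double_eq_iff_rcong[symmetric]
  by (simp add: radial_def m_R_reactivity_radius)

lemma p_T_reactivity_radius:
  "p_T A = complex_of_real (p_amp A * sin (2 * reactivity_radius A))" (is "_ = of_real ?s")
proof -
  have "(p_amp A)\<^sup>2 - (m_R A)\<^sup>2 = ?s\<^sup>2"
    by (simp add: m_R_reactivity_radius power_mult_distrib sin_squared_eq right_diff_distrib)
  \<comment> \<open>Since \<open>csqrt\<close> of \<open>?s\<^sup>2\<close> is the absolute value of
    \<open>?s\<close>, this sign decides which orthovalue belongs to which angle.\<close>
  moreover have "?s \<ge> 0"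
    using p_amp_pos reactivity_radius_nonneg reactivity_radius_le
    by (intro mult_nonneg_nonneg sin_ge_zero) auto
  ultimately show ?thesis
    by (simp add: p_T_def del: of_real_power)
qed

end

text \<open>Doubling the angle turns congruence modulo \<pi> into congruence modulo 2 \<pi>, a
  period of sin.\<close>

lemma tangential_rcong: "[\<phi> = \<psi>] (rmod pi) \<Longrightarrow> tangential A \<phi> = tangential A \<psi>"
  unfolding tangential_def
  by (metis rcong_diff_right_cancel rcong_mult_left_cancel sin_rcong zero_neq_numeral)

theorem theorem5p4:
  fixes A :: "real^2^2"
  shows
    "(\<forall>\<phi>. (orthovector A (tangential A \<phi>) (unit_vec \<phi>) \<longleftrightarrow> radial A \<phi> = 0) \<and>
          (\<forall>\<mu>. orthovector A \<mu> (unit_vec \<phi>) \<longrightarrow> \<mu> = tangential A \<phi>))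
     \<and>
     ((\<exists>\<mu>::real. orthovalue A \<mu>) \<and> (\<exists>\<theta>. radial A \<theta> \<noteq> 0) \<longrightarrow>
       (let \<phi>1 = theta_R A - reactivity_radius A; \<phi>2 = theta_R A + reactivity_radius A in
         (\<forall>V \<mu>. orthovector A \<mu> V \<longleftrightarrow>
            (\<exists>r>0. \<exists>\<phi>. V = r *s unit_vec \<phi> \<and>
               ([\<phi> = \<phi>1] (rmod pi) \<and> \<mu> = tangential A \<phi>1 \<or>
                [\<phi> = \<phi>2] (rmod pi) \<and> \<mu> = tangential A \<phi>2))) \<and>
         complex_of_real (tangential A \<phi>1) = complex_of_real (m_T A) + p_T A \<and>
         complex_of_real (tangential A \<phi>2) = complex_of_real (m_T A) - p_T A))
     \<and>
     ({\<mu>::complex. orthovalue (map_matrix complex_of_real A) \<mu>} =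
        {complex_of_real (m_T A) + p_T A, complex_of_real (m_T A) - p_T A} \<and>
      {\<mu>::real. orthovalue A \<mu>} =
        {\<mu>. complex_of_real \<mu> \<in>
          {complex_of_real (m_T A) + p_T A, complex_of_real (m_T A) - p_T A}} \<and>
      p_T A = csqrt (complex_of_real (- rho1 A * rho2 A)))"
proof (intro conjI allI impI, goal_cases)
  case (1 \<phi>)
  then show ?case by (simp add: orthovector_unit_vec_iff)
next
  case (2 \<phi> \<mu>)
  then show ?case by (simp add: orthovector_unit_vec_iff)
next
  case 3
  then have nonzero: "\<exists>\<theta>. radial A \<theta> \<noteq> 0" by blast
  \<comment> \<open>The polar angle of a real orthovector is a zero of \<open>radial A\<close>, so
    the reactivity radius is well defined.\<close>
  have zero: "\<exists>\<theta>. radial A \<theta> = 0"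
    using 3 unfolding orthovalue_def orthovector_polar_iff by blast
  have *: "radial A \<phi> = 0 \<and> \<mu> = tangential A \<phi> \<longleftrightarrow>
      [\<phi> = theta_R A - reactivity_radius A] (rmod pi) \<and>
        \<mu> = tangential A (theta_R A - reactivity_radius A) \<or>
      [\<phi> = theta_R A + reactivity_radius A] (rmod pi) \<and>
        \<mu> = tangential A (theta_R A + reactivity_radius A)" for \<phi> \<mu>
    unfolding radial_eq_0_iff[OF nonzero zero] using tangential_rcong by metis
  \<comment> \<open>As sin is odd, moving from \<open>theta_R A\<close> by minus or plus the radius
    changes \<open>m_T A\<close> by plus or minus \<open>p_T A\<close>.\<close>
  show ?case
    unfolding Let_def orthovector_polar_iff * p_T_reactivity_radius[OF nonzero zero]
    by (simp add: tangential_def)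
next
  case 4
  show ?case using complex_orthovalue_iff by blast
next
  case 5
  show ?case by (simp only: orthovalue_complex_of_real[symmetric] complex_orthovalue_iff)
next
  case 6
  have "(p_amp A)\<^sup>2 - (m_R A)\<^sup>2 = - rho1 A * rho2 A"
    by (simp add: rho1_def rho2_def power2_eq_square algebra_simps)
  then show ?case by (simp add: p_T_def)
qed

end
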